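(* Let $B$ be a finitely semi-graded (FSG) ring such that $B_0$ is a left noetherian domain. Let $V$ be a generating frame of $B$. Then $$\mathrm{GGKdim}(B)=\limsup_{k\to\infty}\log_k(\mathrm{udim}\,V^k).$$ Moreover, this equality does not depend on the generating frame $V$.
   Context: All rings are unital and not necessarily commutative; modules are left modules. A ring $B$ is semi-graded (SG) if there is a collection $\{B_n\}_{n\ge 0}$ of subgroups of the additive group of $B$ such that: $B=\bigoplus_{n\ge0}B_n$; $B_mB_n\subseteq B_0\oplus\cdots\oplus B_{m+n}$ for all $m,n\ge 0$; and $1\in B_0$. It is finitely semi-graded (FSG) if moreover there are finitely many $x_1,\dots,x_n\in B$ such that the subring generated by $B_0$ and $x_1,\dots,x_n$ is $B$, and every $B_n$ is a free (left) $B_0$-module of finite dimension. $\mathrm{udim}$ denotes the uniform (Goldie) dimension of a left $B_0$-module. A frame of $B$ is a finite dimensional free left $B_0$-submodule $V$ of $B$ such that $1\in V$. For a frame $V$, $V^k:={}_{B_0}\langle v_1\cdots v_k\mid v_i\in V\rangle$ is the left $B_0$-submodule of $B$ generated by all products of $k$ elements of $V$. A frame $V$ is a generating frame if the subring of $B$ generated by $V$ and $B_0$ is $B$. If $B_0$ is a left noetherian domain, the generalized Gelfand-Kirillov dimension of $B$ is $$\mathrm{GGKdim}(B):=\sup_V\limsup_{k\to\infty}\log_k\mathrm{udim}\,V^k,$$ where $V$ ranges over all frames of $B$. *)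

theory Defs
  imports "HOL-Library.Extended_Real"
begin

text \<open>
  The ambient ring is a type of class \<open>ring_1\<close>. Every module considered is a submodule of the
  ambient ring over a subring \<open>R\<close>, acting by left multiplication. Both \<open>R\<close> and its modules are
  therefore subsets of the ambient type.
\<close>

definition additive_subgroup :: "'a::ring_1 set \<Rightarrow> bool" where
  "additive_subgroup S \<longleftrightarrow> 0 \<in> S \<and> (\<forall>x\<in>S. \<forall>y\<in>S. x - y \<in> S)"

definition unital_subring :: "'a::ring_1 set \<Rightarrow> bool" where
  "unital_subring S \<longleftrightarrow> additive_subgroup S \<and> 1 \<in> S \<and> (\<forall>x\<in>S. \<forall>y\<in>S. x * y \<in> S)"

definition left_submodule :: "'a::ring_1 set \<Rightarrow> 'a set \<Rightarrow> bool" where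
  "left_submodule R M \<longleftrightarrow> additive_subgroup M \<and> (\<forall>r\<in>R. \<forall>x\<in>M. r * x \<in> M)"

definition left_independent :: "'a::ring_1 set \<Rightarrow> 'a set \<Rightarrow> bool" where
  "left_independent R X \<longleftrightarrow>
     (\<forall>c. (\<forall>x\<in>X. c x \<in> R) \<longrightarrow> (\<Sum>x\<in>X. c x * x) = 0 \<longrightarrow> (\<forall>x\<in>X. c x = 0))"

definition fin_dim_free :: "'a::ring_1 set \<Rightarrow> 'a set \<Rightarrow> bool" where
  "fin_dim_free R M \<longleftrightarrow>
     (\<exists>X. finite X \<and> left_independent R X \<and> M = left_submodule R hull X)"

definition left_noetherian :: "'a::ring_1 set \<Rightarrow> bool" where
  "left_noetherian R \<longleftrightarrow>
     (\<forall>I. left_submodule R I \<and> I \<subseteq> R \<longrightarrow> (\<exists>X. finite X \<and> I = left_submodule R hull X))"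

text \<open>Nontriviality of the domain is part of the class \<open>ring_1\<close>.\<close>

definition left_noetherian_domain :: "'a::ring_1 set \<Rightarrow> bool" where
  "left_noetherian_domain R \<longleftrightarrow>
     unital_subring R \<and> left_noetherian R \<and> (\<forall>a\<in>R. \<forall>b\<in>R. a * b = 0 \<longrightarrow> a = 0 \<or> b = 0)"

definition uniform_module :: "'a::ring_1 set \<Rightarrow> 'a set \<Rightarrow> bool" where
  "uniform_module R U \<longleftrightarrow> left_submodule R U \<and> U \<noteq> {0} \<and>
     (\<forall>N N'. left_submodule R N \<and> N \<subseteq> U \<and> N \<noteq> {0} \<and>
             left_submodule R N' \<and> N' \<subseteq> U \<and> N' \<noteq> {0} \<longrightarrow> N \<inter> N' \<noteq> {0})"

definition essential_in :: "'a::ring_1 set \<Rightarrow> 'a set \<Rightarrow> 'a set \<Rightarrow> bool" where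
  "essential_in R E M \<longleftrightarrow> left_submodule R E \<and> E \<subseteq> M \<and>
     (\<forall>N. left_submodule R N \<and> N \<subseteq> M \<and> N \<noteq> {0} \<longrightarrow> N \<inter> E \<noteq> {0})"

definition sum_of :: "(nat \<Rightarrow> 'a::ring_1 set) \<Rightarrow> nat \<Rightarrow> 'a set" where
  "sum_of U n = {\<Sum>i<n. u i | u. \<forall>i<n. u i \<in> U i}"

definition direct :: "(nat \<Rightarrow> 'a::ring_1 set) \<Rightarrow> nat \<Rightarrow> bool" where
  "direct U n \<longleftrightarrow>
     (\<forall>u. (\<forall>i<n. u i \<in> U i) \<longrightarrow> (\<Sum>i<n. u i) = 0 \<longrightarrow> (\<forall>i<n. u i = 0))"

definition has_udim :: "'a::ring_1 set \<Rightarrow> 'a set \<Rightarrow> nat \<Rightarrow> bool" where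
  "has_udim R M n \<longleftrightarrow>
     (\<exists>U. (\<forall>i<n. uniform_module R (U i)) \<and> direct U n \<and> essential_in R (sum_of U n) M)"

text \<open>The \<open>n\<close> in \<open>has_udim R M n\<close> is unique by the Steinitz replacement theorem for uniform modules.\<close>

definition udim :: "'a::ring_1 set \<Rightarrow> 'a set \<Rightarrow> enat" where
  "udim R M = (if \<exists>n. has_udim R M n then enat (THE n. has_udim R M n) else \<infinity>)"

text \<open>In the next definition, \<open>b i\<close> is the homogeneous component of \<open>x\<close> in \<open>B i\<close>.\<close>

definition semi_graded :: "(nat \<Rightarrow> 'a::ring_1 set) \<Rightarrow> bool" where
  "semi_graded B \<longleftrightarrow>
     (\<forall>n. additive_subgroup (B n)) \<and>
     (\<forall>x. \<exists>!b. (\<forall>n. b n \<in> B n) \<and> finite {n. b n \<noteq> 0} \<and> x = (\<Sum>n | b n \<noteq> 0. b n)) \<and>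
     (\<forall>m n. \<forall>x\<in>B m. \<forall>y\<in>B n. x * y \<in> sum_of B (Suc (m + n))) \<and>
     1 \<in> B 0"

definition finitely_semi_graded :: "(nat \<Rightarrow> 'a::ring_1 set) \<Rightarrow> bool" where
  "finitely_semi_graded B \<longleftrightarrow>
     semi_graded B \<and>
     (\<exists>X. finite X \<and> unital_subring hull (B 0 \<union> X) = UNIV) \<and>
     (\<forall>n. fin_dim_free (B 0) (B n))"

text \<open>Frames and the dimension depend on the semi-graduation only through \<open>R = B 0\<close>.\<close>

definition frame :: "'a::ring_1 set \<Rightarrow> 'a set \<Rightarrow> bool" where
  "frame R V \<longleftrightarrow> left_submodule R V \<and> fin_dim_free R V \<and> 1 \<in> V"

definition generating_frame :: "'a::ring_1 set \<Rightarrow> 'a set \<Rightarrow> bool" where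
  "generating_frame R V \<longleftrightarrow> frame R V \<and> unital_subring hull (V \<union> R) = UNIV"

definition frame_power :: "'a::ring_1 set \<Rightarrow> 'a set \<Rightarrow> nat \<Rightarrow> 'a set" where
  "frame_power R V k = left_submodule R hull {prod_list vs | vs. length vs = k \<and> set vs \<subseteq> V}"

text \<open>The logarithm for bases greater than 1, extended to \<open>[0, \<infinity>]\<close> in the usual way; the library
  value \<open>log b 0 = 0\<close> is not wanted here. Bases 0 and 1 do not affect a \<open>limsup\<close>.\<close>

definition elog :: "nat \<Rightarrow> enat \<Rightarrow> ereal" where
  "elog k d = (case d of enat n \<Rightarrow> if n = 0 then -\<infinity> else ereal (log (real k) (real n)) | \<infinity> \<Rightarrow> \<infinity>)"

definition frame_growth :: "'a::ring_1 set \<Rightarrow> 'a set \<Rightarrow> ereal" where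
  "frame_growth R V = limsup (\<lambda>k. elog k (udim R (frame_power R V k)))"

definition GGKdim :: "(nat \<Rightarrow> 'a::ring_1 set) \<Rightarrow> ereal" where
  "GGKdim B = (SUP V \<in> {V. frame (B 0) V}. frame_growth (B 0) V)"

end

theory Submission
  imports Defs
begin

text \<open>
  The growth rate of one generating frame \<open>V\<close> already dominates that of every frame \<open>W\<close>. Write
  \<open>R = B 0\<close>. Since \<open>V\<close> is a left \<open>R\<close>-module, a coefficient standing in front of a factor of \<open>V\<close>
  can be absorbed by that factor, so that \<open>V\<^sup>k V\<^sup>l \<subseteq> V\<^sup>k\<^sup>+\<^sup>l\<close> for \<open>l \<ge> 1\<close>
  (\<open>frame_power_mult\<close>). Together with \<open>1 \<in> V\<close> this makes the powers of \<open>V\<close> an ascending chain whose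
  union is a subring, hence the whole ring (\<open>generating_frame_exhausts\<close>). A frame \<open>W\<close> has finitely
  many generators, so it lies in a single power \<open>V\<^sup>m\<close> with \<open>m \<ge> 1\<close>, and then \<open>W\<^sup>k \<subseteq> V\<^sup>m\<^sup>k\<close> for all
  \<open>k\<close> (\<open>frame_power_subset_frame_power\<close>).

  Uniform dimension is monotone under inclusion of submodules (\<open>udim_mono\<close>). This rests on the
  exchange argument \<open>uniform_exchange\<close>: a direct family of submodules that all meet a direct sum of
  \<open>n\<close> uniform modules has at most \<open>n\<close> members. The bound makes the uniform dimension well defined,
  and it also provides, in a submodule, a longest direct family of nonzero submodules; maximality
  forces its members to be uniform and its sum to be essential.

  Hence \<open>log\<^sub>k udim W\<^sup>k \<le> log\<^sub>k udim V\<^sup>m\<^sup>k = (1 + log\<^sub>k m) log\<^sub>m\<^sub>k udim V\<^sup>m\<^sup>k\<close>, and the factor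
  \<open>1 + log\<^sub>k m\<close> tends to \<open>1\<close>. So the limit superior for \<open>W\<close> is at most the one for \<open>V\<close>; as \<open>V\<close> is
  itself a frame, it attains the supremum. This holds for every generating frame, which is the
  claimed independence.
\<close>

section \<open>Submodules\<close>

lemma additive_subgroup_0: "additive_subgroup S \<Longrightarrow> 0 \<in> S"
  by (simp add: additive_subgroup_def)

lemma additive_subgroup_diff: "additive_subgroup S \<Longrightarrow> x \<in> S \<Longrightarrow> y \<in> S \<Longrightarrow> x - y \<in> S"
  by (simp add: additive_subgroup_def)

lemma additive_subgroup_uminus: "additive_subgroup S \<Longrightarrow> x \<in> S \<Longrightarrow> - x \<in> S"
  using additive_subgroup_diff[of S 0 x] by (simp add: additive_subgroup_0)

lemma additive_subgroup_add: "additive_subgroup S \<Longrightarrow> x \<in> S \<Longrightarrow> y \<in> S \<Longrightarrow> x + y \<in> S"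
  using additive_subgroup_diff[of S x "- y"] by (simp add: additive_subgroup_uminus)

lemma additive_subgroup_sum:
  assumes "additive_subgroup S" "\<And>i. i \<in> I \<Longrightarrow> f i \<in> S"
  shows "sum f I \<in> S"
  using assms
  by (induction I rule: infinite_finite_induct)
    (auto simp: additive_subgroup_0 intro: additive_subgroup_add)

lemma left_submodule_additive: "left_submodule R M \<Longrightarrow> additive_subgroup M"
  by (simp add: left_submodule_def)

lemma left_submodule_smult: "left_submodule R M \<Longrightarrow> r \<in> R \<Longrightarrow> x \<in> M \<Longrightarrow> r * x \<in> M"
  by (simp add: left_submodule_def)

lemmas left_submodule_0 = additive_subgroup_0[OF left_submodule_additive]
  and left_submodule_diff = additive_subgroup_diff[OF left_submodule_additive]
  and left_submodule_uminus = additive_subgroup_uminus[OF left_submodule_additive]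
  and left_submodule_add = additive_subgroup_add[OF left_submodule_additive]
  and left_submodule_sum = additive_subgroup_sum[OF left_submodule_additive]

lemma left_submodule_Int:
  "left_submodule R M \<Longrightarrow> left_submodule R N \<Longrightarrow> left_submodule R (M \<inter> N)"
  by (simp add: left_submodule_def additive_subgroup_def)

lemma left_submodule_hull: "left_submodule R (left_submodule R hull X)"
  by (rule hull_in) (auto simp: left_submodule_def additive_subgroup_def)

lemma left_submodule_cyclic:
  assumes "unital_subring R"
  shows "left_submodule R ((\<lambda>r. r * x) ` R)"
  unfolding left_submodule_def additive_subgroup_def
proof (intro conjI ballI)
  show "0 \<in> (\<lambda>r. r * x) ` R"
    using assms by (auto simp: unital_subring_def additive_subgroup_def image_iff intro!: bexI[of _ 0])
next
  fix a b
  assume "a \<in> (\<lambda>r. r * x) ` R" "b \<in> (\<lambda>r. r * x) ` R"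
  then obtain r s where "r \<in> R" "s \<in> R" "a = r * x" "b = s * x"
    by auto
  moreover from this have "r - s \<in> R"
    using assms by (simp add: unital_subring_def additive_subgroup_def)
  ultimately show "a - b \<in> (\<lambda>r. r * x) ` R"
    by (auto simp: image_iff left_diff_distrib[symmetric])
next
  fix t a
  assume "t \<in> R" "a \<in> (\<lambda>r. r * x) ` R"
  then show "t * a \<in> (\<lambda>r. r * x) ` R"
    using assms by (auto simp: unital_subring_def image_iff mult.assoc[symmetric])
qed

lemma nonzero_elementE:
  assumes "left_submodule R M" "M \<noteq> {0}"
  obtains x where "x \<in> M" "x \<noteq> 0"
  using assms left_submodule_0[of R M] by blast

section \<open>Direct families over a base submodule\<close>

text \<open>
  In the exchange argument uniform summands move one at a time out of a family into a fixed
  submodule \<open>K\<close>. Both notions therefore carry that submodule and an arbitrary index set;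
  \<open>sum_of\<close> and \<open>direct\<close> are the case \<open>K = {0}\<close>.
\<close>

definition sum_over :: "'a::ring_1 set \<Rightarrow> ('i \<Rightarrow> 'a set) \<Rightarrow> 'i set \<Rightarrow> 'a set" where
  "sum_over K U I = {k + (\<Sum>i\<in>I. u i) | k u. k \<in> K \<and> (\<forall>i\<in>I. u i \<in> U i)}"

definition direct_over :: "'a::ring_1 set \<Rightarrow> ('i \<Rightarrow> 'a set) \<Rightarrow> 'i set \<Rightarrow> bool" where
  "direct_over K U I \<longleftrightarrow>
     (\<forall>k u. k \<in> K \<longrightarrow> (\<forall>i\<in>I. u i \<in> U i) \<longrightarrow> k + (\<Sum>i\<in>I. u i) = 0 \<longrightarrow> (\<forall>i\<in>I. u i = 0))"

lemma sum_of_eq_sum_over: "sum_of U n = sum_over {0} U {..<n}"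
  by (auto simp: sum_of_def sum_over_def)

lemma direct_eq_direct_over: "direct U n \<longleftrightarrow> direct_over {0} U {..<n}"
  by (auto simp: direct_def direct_over_def)

lemma sum_over_memI:
  "k \<in> K \<Longrightarrow> (\<And>i. i \<in> I \<Longrightarrow> u i \<in> U i) \<Longrightarrow> k + (\<Sum>i\<in>I. u i) \<in> sum_over K U I"
  by (auto simp: sum_over_def)

lemma sum_over_memE:
  assumes "x \<in> sum_over K U I"
  obtains k u where "k \<in> K" "\<And>i. i \<in> I \<Longrightarrow> u i \<in> U i" "x = k + (\<Sum>i\<in>I. u i)"
  using assms by (auto simp: sum_over_def)

lemma direct_overD:
  "direct_over K U I \<Longrightarrow> k \<in> K \<Longrightarrow> (\<And>i. i \<in> I \<Longrightarrow> u i \<in> U i) \<Longrightarrow>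
    k + (\<Sum>i\<in>I. u i) = 0 \<Longrightarrow> i \<in> I \<Longrightarrow> u i = 0"
  by (auto simp: direct_over_def)

lemma left_submodule_sum_over:
  assumes "left_submodule R K" "\<And>i. i \<in> I \<Longrightarrow> left_submodule R (U i)"
  shows "left_submodule R (sum_over K U I)"
  unfolding left_submodule_def additive_subgroup_def
proof (intro conjI ballI)
  show "0 \<in> sum_over K U I"
    using sum_over_memI[of 0 K I "\<lambda>_. 0" U] assms by (auto intro: left_submodule_0)
next
  fix x y
  assume x: "x \<in> sum_over K U I" and y: "y \<in> sum_over K U I"
  obtain k u where k: "k \<in> K" "\<And>i. i \<in> I \<Longrightarrow> u i \<in> U i" "x = k + (\<Sum>i\<in>I. u i)"
    using x by (elim sum_over_memE) blast
  obtain l v where l: "l \<in> K" "\<And>i. i \<in> I \<Longrightarrow> v i \<in> U i" "y = l + (\<Sum>i\<in>I. v i)"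
    using y by (elim sum_over_memE) blast
  have "(k - l) + (\<Sum>i\<in>I. u i - v i) \<in> sum_over K U I"
    using k(1,2) l(1,2) assms by (intro sum_over_memI) (auto intro: left_submodule_diff)
  then show "x - y \<in> sum_over K U I"
    using k(3) l(3) by (simp add: sum_subtractf algebra_simps)
next
  fix r x
  assume r: "r \<in> R" and "x \<in> sum_over K U I"
  then obtain k u where k: "k \<in> K" "\<And>i. i \<in> I \<Longrightarrow> u i \<in> U i" "x = k + (\<Sum>i\<in>I. u i)"
    by (elim sum_over_memE) blast
  have "r * k + (\<Sum>i\<in>I. r * u i) \<in> sum_over K U I"
    using k(1,2) r assms by (intro sum_over_memI) (auto intro: left_submodule_smult)
  then show "r * x \<in> sum_over K U I"
    using k(3) by (simp add: sum_distrib_left distrib_left)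
qed

lemma base_subset_sum_over:
  assumes "\<And>i. i \<in> I \<Longrightarrow> left_submodule R (U i)"
  shows "K \<subseteq> sum_over K U I"
proof
  fix k
  assume "k \<in> K"
  then show "k \<in> sum_over K U I"
    using sum_over_memI[of k K I "\<lambda>_. 0" U] assms by (auto intro: left_submodule_0)
qed

lemma summand_subset_sum_over:
  assumes "finite I" "i \<in> I" "left_submodule R K" "\<And>i. i \<in> I \<Longrightarrow> left_submodule R (U i)"
  shows "U i \<subseteq> sum_over K U I"
proof
  fix x
  assume "x \<in> U i"
  then have "0 + (\<Sum>j\<in>I. if j = i then x else 0) \<in> sum_over K U I"
    using assms by (intro sum_over_memI) (auto intro: left_submodule_0)
  then show "x \<in> sum_over K U I"
    using assms(1,2) by simp
qed

lemma sum_over_subset: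
  assumes "left_submodule R M" "K \<subseteq> M" "\<And>i. i \<in> I \<Longrightarrow> U i \<subseteq> M"
  shows "sum_over K U I \<subseteq> M"
proof
  fix x
  assume "x \<in> sum_over K U I"
  then obtain k u where "k \<in> K" "\<And>i. i \<in> I \<Longrightarrow> u i \<in> U i" "x = k + (\<Sum>i\<in>I. u i)"
    by (elim sum_over_memE) blast
  then show "x \<in> M"
    using assms by (auto intro!: left_submodule_add[of R M] left_submodule_sum[of R M])
qed

lemma sum_over_absorb:
  assumes "finite I" "i \<in> I"
  shows "sum_over (sum_over K U {i}) U (I - {i}) = sum_over K U I"
proof (intro subset_antisym subsetI)
  fix x
  assume "x \<in> sum_over (sum_over K U {i}) U (I - {i})"
  then obtain k u v where k: "k \<in> K" and "v i \<in> U i" "\<And>j. j \<in> I - {i} \<Longrightarrow> u j \<in> U j"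
    and x: "x = (k + v i) + (\<Sum>j\<in>I - {i}. u j)"
    by (fastforce elim!: sum_over_memE)
  then have "k + (\<Sum>j\<in>I. (u(i := v i)) j) \<in> sum_over K U I"
    by (intro sum_over_memI) auto
  moreover have "(\<Sum>j\<in>I. (u(i := v i)) j) = v i + (\<Sum>j\<in>I - {i}. u j)"
    by (subst sum.remove[OF assms]) (auto intro!: sum.cong)
  ultimately show "x \<in> sum_over K U I"
    by (simp add: x add.assoc)
next
  fix x
  assume "x \<in> sum_over K U I"
  then obtain k u where k: "k \<in> K" and u: "\<And>j. j \<in> I \<Longrightarrow> u j \<in> U j"
    and x: "x = k + (\<Sum>j\<in>I. u j)"
    by (elim sum_over_memE) blast
  have "k + (\<Sum>j\<in>{i}. u j) \<in> sum_over K U {i}"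
    using k u assms by (intro sum_over_memI) auto
  then have "(k + (\<Sum>j\<in>{i}. u j)) + (\<Sum>j\<in>I - {i}. u j)
      \<in> sum_over (sum_over K U {i}) U (I - {i})"
    using u by (intro sum_over_memI[of "k + (\<Sum>j\<in>{i}. u j)"]) auto
  then show "x \<in> sum_over (sum_over K U {i}) U (I - {i})"
    by (simp add: x sum.remove[OF assms] add.assoc)
qed

lemma direct_over_absorb:
  assumes "direct_over K U I" "finite I" "i \<in> I"
  shows "direct_over (sum_over K U {i}) U (I - {i})"
  unfolding direct_over_def
proof (intro allI impI ballI)
  fix k u j
  assume "k \<in> sum_over K U {i}" and u: "\<forall>j\<in>I - {i}. u j \<in> U j"
    and 0: "k + (\<Sum>j\<in>I - {i}. u j) = 0" and j: "j \<in> I - {i}"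
  then obtain l v where l: "l \<in> K" "v i \<in> U i" "k = l + v i"
    by (fastforce elim!: sum_over_memE)
  have "(\<Sum>j\<in>I. (u(i := v i)) j) = v i + (\<Sum>j\<in>I - {i}. u j)"
    by (subst sum.remove[OF assms(2,3)]) (auto intro!: sum.cong)
  then have "l + (\<Sum>j\<in>I. (u(i := v i)) j) = 0"
    using 0 l by (simp add: add.assoc)
  then have "(u(i := v i)) j = 0"
    using l u j by (intro direct_overD[OF assms(1), of l "u(i := v i)" j]) auto
  then show "u j = 0"
    using j by auto
qed

lemma direct_over_subset:
  assumes "direct_over K W J" "finite J" "J' \<subseteq> J" "\<And>j. j \<in> J \<Longrightarrow> left_submodule R (W j)"
  shows "direct_over K W J'"
  unfolding direct_over_def
proof (intro allI impI ballI)
  fix k u j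
  assume k: "k \<in> K" and u: "\<forall>j\<in>J'. u j \<in> W j" and 0: "k + (\<Sum>j\<in>J'. u j) = 0" and j: "j \<in> J'"
  let ?v = "\<lambda>j. if j \<in> J' then u j else 0"
  have "(\<Sum>j\<in>J. ?v j) = (\<Sum>j\<in>J'. u j)"
    using assms(2,3) by (simp add: sum.If_cases Int_absorb1)
  then have "?v j = 0"
    using k u 0 j assms(3,4)
    by (intro direct_overD[OF assms(1) k, of ?v]) (auto intro: left_submodule_0)
  then show "u j = 0"
    using j by simp
qed

lemma direct_over_summand_Int:
  assumes "direct_over K W J" "finite J" "j \<in> J" "left_submodule R K"
    "\<And>j. j \<in> J \<Longrightarrow> left_submodule R (W j)"
  shows "W j \<inter> sum_over K W (J - {j}) = {0}"
proof -
  have "x = 0" if x: "x \<in> W j" "x \<in> sum_over K W (J - {j})" for x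
  proof -
    obtain k w where k: "k \<in> K" and w: "\<And>i. i \<in> J - {j} \<Longrightarrow> w i \<in> W i"
      and xeq: "x = k + (\<Sum>i\<in>J - {j}. w i)"
      using x(2) by (elim sum_over_memE) blast
    have "(\<Sum>i\<in>J. (w(j := - x)) i) = - x + (\<Sum>i\<in>J - {j}. w i)"
      by (subst sum.remove[OF assms(2,3)]) (auto intro!: sum.cong)
    then have "k + (\<Sum>i\<in>J. (w(j := - x)) i) = 0"
      using xeq by simp
    then have "(w(j := - x)) j = 0"
      using k w x(1) assms(3,5)
      by (intro direct_overD[OF assms(1) k, of "w(j := - x)" j]) (auto intro: left_submodule_uminus)
    then show ?thesis
      by simp
  qed
  moreover have "0 \<in> W j \<inter> sum_over K W (J - {j})"
    using left_submodule_0[OF assms(5)[OF assms(3)]]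
      left_submodule_0[OF left_submodule_sum_over[OF assms(4), of "J - {j}" W]] assms(5)
    by blast
  ultimately show ?thesis
    by blast
qed

lemma direct_over_enlarge_base:
  assumes "direct_over K W J" "left_submodule R K" "\<And>j. j \<in> J \<Longrightarrow> left_submodule R (W j)"
    "left_submodule R (U i)" "U i \<inter> sum_over K W J = {0}"
  shows "direct_over (sum_over K U {i}) W J"
  unfolding direct_over_def
proof (intro allI impI ballI)
  fix k w j
  assume "k \<in> sum_over K U {i}" and w: "\<forall>j\<in>J. w j \<in> W j"
    and 0: "k + (\<Sum>j\<in>J. w j) = 0" and j: "j \<in> J"
  then obtain l u where l: "l \<in> K" "u \<in> U i" "k = l + u"
    by (fastforce elim!: sum_over_memE)
  have "l + (\<Sum>j\<in>J. w j) \<in> sum_over K W J"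
    using l(1) w by (intro sum_over_memI) auto
  moreover have "l + (\<Sum>j\<in>J. w j) = - u"
    using 0 l(3) by (simp add: eq_neg_iff_add_eq_0 ac_simps)
  ultimately have "- u \<in> sum_over K W J"
    by simp
  then have "- u \<in> U i \<inter> sum_over K W J"
    using l(2) assms(4) by (auto intro: left_submodule_uminus)
  then have "u = 0"
    using assms(5) by simp
  then show "w j = 0"
    using 0 l w j by (intro direct_overD[OF assms(1) l(1), of w]) auto
qed

section \<open>Uniform dimension\<close>

text \<open>
  In a uniform module every nonzero submodule is essential, so every nonzero element has a nonzero
  multiple in it.
\<close>

lemma uniform_multiple_in:
  assumes "unital_subring R" "uniform_module R U" "left_submodule R N" "U \<inter> N \<noteq> {0}"
    "u \<in> U" "u \<noteq> 0"
  obtains r where "r \<in> R" "r * u \<in> N" "r * u \<noteq> 0"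
proof -
  let ?C = "(\<lambda>r. r * u) ` R"
  have U: "left_submodule R U"
    using assms(2) by (simp add: uniform_module_def)
  have C: "left_submodule R ?C"
    by (rule left_submodule_cyclic[OF assms(1)])
  have "u \<in> ?C"
    using assms(1) by (auto simp: unital_subring_def image_iff intro!: bexI[of _ 1])
  then have "?C \<noteq> {0}"
    using assms(6) by auto
  moreover have "?C \<subseteq> U"
    using U assms(5) by (auto intro: left_submodule_smult)
  ultimately have "?C \<inter> (U \<inter> N) \<noteq> {0}"
    using assms(2,4) C left_submodule_Int[OF U assms(3)] by (simp add: uniform_module_def)
  then obtain y where "y \<in> ?C \<inter> (U \<inter> N)" "y \<noteq> 0"
    using nonzero_elementE[OF left_submodule_Int[OF C left_submodule_Int[OF U assms(3)]]] by blast
  then show thesis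
    using that by auto
qed

text \<open>
  Multiplying \<open>x\<close> by a suitable scalar brings one more component into \<open>N\<close> and keeps that component nonzero; directness then keeps the whole multiple of \<open>x\<close> nonzero, and the
  components already in \<open>N\<close> stay there. The induction is on the set of components outside \<open>N\<close>. In
  the exchange argument this says that \<open>N\<close> meets every nonzero submodule of \<open>K \<oplus> \<Oplus>\<^sub>i U i\<close>.
\<close>

lemma multiple_in_of_meets_summands:
  assumes R: "unital_subring R"
    and U: "\<And>i. i \<in> I \<Longrightarrow> uniform_module R (U i)"
    and "finite I" "direct_over K U I" "left_submodule R K" "left_submodule R N" "K \<subseteq> N"
    and meets: "\<And>i. i \<in> I \<Longrightarrow> U i \<inter> N \<noteq> {0}"
    and "x \<in> sum_over K U I" "x \<noteq> 0"
  shows "\<exists>r\<in>R. r * x \<in> N \<and> r * x \<noteq> 0"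
proof -
  have "\<exists>r\<in>R. r * x \<in> N \<and> r * x \<noteq> 0"
    if "k \<in> K" "\<And>i. i \<in> I \<Longrightarrow> u i \<in> U i" "x = k + (\<Sum>i\<in>I. u i)" "x \<noteq> 0" for k u x
    using that
  proof (induction "card {i\<in>I. u i \<notin> N}" arbitrary: k u x rule: less_induct)
    case less
    show ?case
    proof (cases "\<exists>i\<in>I. u i \<notin> N")
      case False
      then have "x \<in> N"
        using less.prems assms(6,7)
        by (auto intro!: left_submodule_add[of R N] left_submodule_sum[of R N])
      then show ?thesis
        using less.prems(4) R by (auto simp: unital_subring_def intro!: bexI[of _ 1])
    next
      case True
      then obtain i where i: "i \<in> I" "u i \<notin> N"
        by blast
      then have "u i \<noteq> 0"
        using left_submodule_0[OF assms(6)] by auto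
      then obtain r where r: "r \<in> R" "r * u i \<in> N" "r * u i \<noteq> 0"
        using uniform_multiple_in[OF R U[OF i(1)] assms(6) meets[OF i(1)] less.prems(2)[OF i(1)]]
        by blast
      have rx: "r * x = r * k + (\<Sum>i\<in>I. r * u i)"
        using less.prems(3) by (simp add: sum_distrib_left distrib_left)
      have rk: "r * k \<in> K"
        using less.prems(1) r(1) assms(5) by (auto intro: left_submodule_smult)
      have ru: "r * u j \<in> U j" if "j \<in> I" for j
        using less.prems(2)[OF that] r(1) U[OF that]
        by (auto simp: uniform_module_def intro: left_submodule_smult)
      have "r * x \<noteq> 0"
        using direct_overD[OF assms(4) rk, of "\<lambda>j. r * u j" i] ru rx i(1) r(3) by auto
      moreover have "{j\<in>I. r * u j \<notin> N} \<subset> {j\<in>I. u j \<notin> N}"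
        using i r assms(6) by (auto intro: left_submodule_smult)
      then have "card {j\<in>I. r * u j \<notin> N} < card {j\<in>I. u j \<notin> N}"
        using assms(3) by (intro psubset_card_mono) auto
      ultimately have "\<exists>s\<in>R. s * (r * x) \<in> N \<and> s * (r * x) \<noteq> 0"
        using less.hyps[of "\<lambda>j. r * u j" "r * k" "r * x"] rk ru rx by blast
      then show ?thesis
        using r(1) R by (auto simp: unital_subring_def mult.assoc[symmetric])
    qed
  qed
  then show ?thesis
    using assms(9,10) by (elim sum_over_memE) blast
qed

text \<open>
  Steinitz exchange. Take out one member \<open>W j\<close>. The remaining sum \<open>K \<oplus> \<Oplus>\<^sub>l W l\<close> over \<open>l \<noteq> j\<close> misses
  \<open>W j\<close>, so it cannot meet every \<open>U i\<close>: a nonzero element of \<open>W j\<close> in \<open>K \<oplus> \<Oplus>\<^sub>i U i\<close> would then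
  have a nonzero multiple in it. A summand \<open>U i\<close> that it misses replaces \<open>W j\<close>: it is added
  to the base \<open>K\<close>, over which the two shorter families are again direct.
\<close>

lemma uniform_exchange:
  assumes R: "unital_subring R"
    and "finite I" "finite J" "left_submodule R K"
    and "\<And>i. i \<in> I \<Longrightarrow> uniform_module R (U i)" "direct_over K U I"
    and "\<And>j. j \<in> J \<Longrightarrow> left_submodule R (W j)" "direct_over K W J"
    and "\<And>j. j \<in> J \<Longrightarrow> W j \<inter> sum_over K U I \<noteq> {0}"
  shows "card J \<le> card I"
  using assms(2-)
proof (induction "card I" arbitrary: I J K rule: less_induct)
  case less
  note I = less.prems(1) and J = less.prems(2) and K = less.prems(3) and U = less.prems(4)
    and dU = less.prems(5) and W = less.prems(6) and dW = less.prems(7) and meets = less.prems(8)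
  have Us: "left_submodule R (U i)" if "i \<in> I" for i
    using U[OF that] by (simp add: uniform_module_def)
  show ?case
  proof (cases "J = {}")
    case False
    then obtain j where j: "j \<in> J"
      by blast
    let ?K' = "sum_over K W (J - {j})"
    have K': "left_submodule R ?K'"
      using K W by (intro left_submodule_sum_over) auto
    have miss: "W j \<inter> ?K' = {0}"
      by (rule direct_over_summand_Int[OF dW J j K W])
    have "\<exists>i\<in>I. U i \<inter> ?K' = {0}"
    proof (rule ccontr)
      assume "\<not> ?thesis"
      then have all: "\<And>i. i \<in> I \<Longrightarrow> U i \<inter> ?K' \<noteq> {0}"
        by blast
      have "left_submodule R (W j \<inter> sum_over K U I)"
        using W[OF j] left_submodule_sum_over[OF K Us] by (rule left_submodule_Int)
      then obtain x where x: "x \<in> W j" "x \<in> sum_over K U I" "x \<noteq> 0"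
        using nonzero_elementE[OF _ meets[OF j]] by blast
      have "K \<subseteq> ?K'"
        using W by (intro base_subset_sum_over) auto
      then obtain r where "r \<in> R" "r * x \<in> ?K'" "r * x \<noteq> 0"
        using multiple_in_of_meets_summands[OF R U I dU K K' _ all x(2,3)] by blast
      then show False
        using miss left_submodule_smult[OF W[OF j] _ x(1)] by blast
    qed
    then obtain i where i: "i \<in> I" "U i \<inter> ?K' = {0}"
      by blast
    let ?K'' = "sum_over K U {i}"
    have "card (J - {j}) \<le> card (I - {i})"
    proof (rule less.hyps)
      show "card (I - {i}) < card I"
        using I i(1) by (rule card_Diff1_less)
      show "left_submodule R ?K''"
        using K Us i(1) by (intro left_submodule_sum_over) auto
      show "direct_over ?K'' U (I - {i})"
        by (rule direct_over_absorb[OF dU I i(1)])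
      have "direct_over K W (J - {j})"
        by (rule direct_over_subset[OF dW J _ W]) auto
      then show "direct_over ?K'' W (J - {j})"
        using K W Us[OF i(1)] i(2)
        by (intro direct_over_enlarge_base[where R = R and K = K and U = U and i = i
              and W = W and J = "J - {j}"]) auto
      show "W l \<inter> sum_over ?K'' U (I - {i}) \<noteq> {0}" if "l \<in> J - {j}" for l
        using meets that sum_over_absorb[OF I i(1), of K U] by simp
    qed (use I J U W in auto)
    moreover have "card I > 0"
      using I i(1) card_gt_0_iff by blast
    ultimately show ?thesis
      using I J i(1) j by simp
  qed auto
qed

lemma left_submodule_zero: "left_submodule R {0}"
  by (simp add: left_submodule_def additive_subgroup_def)

lemma has_udim_bound:
  assumes "unital_subring R" "has_udim R M n"
    and "\<And>i. i < p \<Longrightarrow> left_submodule R (W i) \<and> W i \<noteq> {0} \<and> W i \<subseteq> M" "direct W p"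
  shows "p \<le> n"
proof -
  obtain U where U: "\<And>i. i < n \<Longrightarrow> uniform_module R (U i)" "direct U n"
    "essential_in R (sum_of U n) M"
    using assms(2) by (auto simp: has_udim_def)
  have "card {..<p} \<le> card {..<n}"
  proof (rule uniform_exchange[where R = R and K = "{0}" and U = U and W = W])
    show "W j \<inter> sum_over {0} U {..<n} \<noteq> {0}" if "j \<in> {..<p}" for j
      using U(3) assms(3) that by (auto simp: essential_in_def sum_of_eq_sum_over)
  qed (use U assms(1,3,4) left_submodule_zero in \<open>auto simp: direct_eq_direct_over\<close>)
  then show ?thesis
    by simp
qed

lemma has_udim_unique:
  assumes "unital_subring R" "has_udim R M n" "has_udim R M m"
  shows "n = m"
proof -
  have "b \<le> a" if a: "has_udim R M a" and b: "has_udim R M b" for a b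
  proof -
    obtain U where U: "\<And>i. i < b \<Longrightarrow> uniform_module R (U i)" "direct U b"
      "sum_of U b \<subseteq> M"
      using b by (auto simp: has_udim_def essential_in_def)
    show ?thesis
    proof (rule has_udim_bound[OF assms(1) a _ U(2)])
      fix i
      assume i: "i < b"
      have "U i \<subseteq> sum_of U b"
        using summand_subset_sum_over[of "{..<b}" i R "{0}" U] U(1) i
        by (simp add: sum_of_eq_sum_over left_submodule_zero uniform_module_def)
      then show "left_submodule R (U i) \<and> U i \<noteq> {0} \<and> U i \<subseteq> M"
        using U(1)[OF i] U(3) by (simp add: uniform_module_def)
    qed
  qed
  then show ?thesis
    using assms by (meson le_antisym)
qed

lemma udim_eqI: "unital_subring R \<Longrightarrow> has_udim R M n \<Longrightarrow> udim R M = enat n"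
  unfolding udim_def using has_udim_unique by (auto intro!: the_equality)

text \<open>
  The witness is a direct family of nonzero submodules of \<open>N\<close> of the greatest possible length. If a
  member were not uniform, it could be split into two; if the sum were not essential, a submodule
  missing it could be appended. Both give a longer family.
\<close>

lemma has_udim_submodule:
  assumes R: "unital_subring R" and "has_udim R M n" "left_submodule R N" "N \<subseteq> M"
  obtains p where "p \<le> n" "has_udim R N p"
proof -
  define fam where "fam W p \<longleftrightarrow>
    (\<forall>i<p. left_submodule R (W i) \<and> W i \<noteq> {0} \<and> W i \<subseteq> N) \<and> direct W p" for W :: "nat \<Rightarrow> 'a set" and p
  have bound: "p \<le> n" if "fam W p" for W p
    using that assms(4) by (intro has_udim_bound[OF R assms(2), of p W]) (auto simp: fam_def)
  have "\<exists>W. fam W 0"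
    by (auto simp: fam_def direct_def)
  then obtain p where "\<exists>W. fam W p" and max: "\<And>q. \<exists>W. fam W q \<Longrightarrow> q \<le> p"
    using Nat.ex_has_greatest_nat[of "\<lambda>p. \<exists>W. fam W p" 0 n] bound by blast
  then obtain W where fam: "fam W p"
    by blast
  have W: "left_submodule R (W i)" "W i \<noteq> {0}" "W i \<subseteq> N" if "i < p" for i
    using fam that by (auto simp: fam_def)
  have dW: "(\<Sum>i<p. u i) = 0 \<Longrightarrow> (\<And>i. i < p \<Longrightarrow> u i \<in> W i) \<Longrightarrow> i < p \<Longrightarrow> u i = 0" for u i
    using fam by (auto simp: fam_def direct_def)
  have no_longer: "\<not> fam W' (Suc p)" for W'
    using max[of "Suc p"] by auto
  have "uniform_module R (W i)" if i: "i < p" for i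
  proof (rule ccontr)
    assume "\<not> uniform_module R (W i)"
    then obtain A A' where A: "left_submodule R A" "A \<subseteq> W i" "A \<noteq> {0}"
      and A': "left_submodule R A'" "A' \<subseteq> W i" "A' \<noteq> {0}" and AA': "A \<inter> A' = {0}"
      using W[OF i] by (auto simp: uniform_module_def)
    let ?W' = "W(i := A, p := A')"
    have "direct ?W' (Suc p)"
      unfolding direct_def
    proof (intro allI impI)
      fix u l
      assume u: "\<forall>j<Suc p. u j \<in> ?W' j" and 0: "(\<Sum>j<Suc p. u j) = 0" and l: "l < Suc p"
      have ui: "u i \<in> A" and up: "u p \<in> A'"
        using u[rule_format, of i] u[rule_format, of p] i by auto
      \<comment> \<open>Collect the two pieces of \<open>W i\<close> in one component of the original family.\<close>
      let ?v = "u(i := u i + u p)"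
      have vsum: "(\<Sum>j<p. ?v j) = 0"
      proof -
        have "(\<Sum>j<p. ?v j) = (u i + u p) + (\<Sum>j\<in>{..<p} - {i}. u j)"
          using i by (subst sum.remove[of _ i]) (auto intro!: sum.cong)
        moreover have "(\<Sum>j<p. u j) = u i + (\<Sum>j\<in>{..<p} - {i}. u j)"
          using i by (intro sum.remove) auto
        ultimately show ?thesis
          using 0 by (simp add: algebra_simps)
      qed
      have vW: "?v j \<in> W j" if "j < p" for j
        using u[rule_format, of j] that ui up A(2) A'(2) W(1)[OF i]
        by (auto intro!: left_submodule_add[of R "W i"])
      have v0: "?v j = 0" if "j < p" for j
        using dW[OF vsum vW that] by blast
      have "u i = - u p"
        using v0[OF i] by (simp add: eq_neg_iff_add_eq_0)
      then have "u i \<in> A \<inter> A'"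
        using ui up A'(1) by (auto intro: left_submodule_uminus)
      then have "u i = 0" "u p = 0"
        using AA' \<open>u i = - u p\<close> by auto
      then show "u l = 0"
        using v0[of l] l by (cases "l = p"; cases "l = i") auto
    qed
    moreover have "A \<subseteq> N" "A' \<subseteq> N"
      using A(2) A'(2) W(3)[OF i] by auto
    then have "left_submodule R (?W' j) \<and> ?W' j \<noteq> {0} \<and> ?W' j \<subseteq> N" if "j < Suc p" for j
      using W[of j] A A' that by (auto simp: less_Suc_eq)
    ultimately have "fam ?W' (Suc p)"
      by (simp add: fam_def)
    then show False
      using no_longer by blast
  qed
  moreover have "essential_in R (sum_of W p) N"
    unfolding essential_in_def
  proof (intro conjI allI impI)
    show sub: "left_submodule R (sum_of W p)"
      unfolding sum_of_eq_sum_over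
      using W by (intro left_submodule_sum_over left_submodule_zero) auto
    show "sum_of W p \<subseteq> N"
      unfolding sum_of_eq_sum_over
      using W(3) left_submodule_0[OF assms(3)] by (intro sum_over_subset[OF assms(3)]) auto
    fix N'
    assume N': "left_submodule R N' \<and> N' \<subseteq> N \<and> N' \<noteq> {0}"
    show "N' \<inter> sum_of W p \<noteq> {0}"
    proof
      assume miss: "N' \<inter> sum_of W p = {0}"
      let ?W' = "W(p := N')"
      have "direct ?W' (Suc p)"
        unfolding direct_def
      proof (intro allI impI)
        fix u l
        assume u: "\<forall>j<Suc p. u j \<in> ?W' j" and 0: "(\<Sum>j<Suc p. u j) = 0" and l: "l < Suc p"
        have up: "u p \<in> N'" and uW: "\<And>j. j < p \<Longrightarrow> u j \<in> W j"
          using u by (auto simp: less_Suc_eq)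
        have "(\<Sum>j<p. u j) \<in> sum_of W p"
          using uW by (auto simp: sum_of_def)
        moreover have "u p = - (\<Sum>j<p. u j)"
          using 0 by (simp add: eq_neg_iff_add_eq_0 add.commute)
        ultimately have "u p \<in> sum_of W p"
          using left_submodule_uminus[OF sub] by simp
        then have "u p = 0"
          using up miss by blast
        moreover from this have "(\<Sum>j<p. u j) = 0"
          using 0 by simp
        then have "u j = 0" if "j < p" for j
          using dW[OF _ uW that] by blast
        ultimately show "u l = 0"
          using l by (auto simp: less_Suc_eq)
      qed
      moreover have "left_submodule R (?W' j) \<and> ?W' j \<noteq> {0} \<and> ?W' j \<subseteq> N" if "j < Suc p" for j
        using W[of j] N' that by (auto simp: less_Suc_eq)
      ultimately have "fam ?W' (Suc p)"
        by (simp add: fam_def)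
      then show False
        using no_longer by blast
    qed
  qed
  ultimately have "has_udim R N p"
    using fam by (auto simp: has_udim_def fam_def)
  then show thesis
    using that bound[OF fam] by blast
qed

lemma udim_mono:
  assumes "unital_subring R" "left_submodule R N" "N \<subseteq> M"
  shows "udim R N \<le> udim R M"
proof (cases "\<exists>n. has_udim R M n")
  case True
  then obtain n where n: "has_udim R M n"
    by blast
  then obtain p where "p \<le> n" "has_udim R N p"
    using has_udim_submodule[OF assms(1) n assms(2,3)] by blast
  then show ?thesis
    using n by (simp add: udim_eqI[OF assms(1)])
next
  case False
  then show ?thesis
    by (simp add: udim_def)
qed

section \<open>Powers of a frame\<close>

lemma left_submodule_frame_power: "left_submodule R (frame_power R V k)"
  unfolding frame_power_def by (rule left_submodule_hull)

lemma prod_list_in_frame_power: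
  "length vs = k \<Longrightarrow> set vs \<subseteq> V \<Longrightarrow> prod_list vs \<in> frame_power R V k"
  unfolding frame_power_def by (rule hull_inc) auto

lemma frame_power_least:
  assumes "left_submodule R M" "\<And>vs. length vs = k \<Longrightarrow> set vs \<subseteq> V \<Longrightarrow> prod_list vs \<in> M"
  shows "frame_power R V k \<subseteq> M"
  unfolding frame_power_def by (rule hull_minimal) (use assms in auto)

text \<open>
  Scalars act on the left only, so in \<open>x * (r * y)\<close> the scalar is trapped between the two factors.
  If \<open>y\<close> is a product of at least one element of \<open>V\<close>, its first factor absorbs \<open>r\<close>; for
  \<open>frame_power R V 0\<close> in the second position the inclusion can fail.
\<close>

lemma frame_power_mult:
  assumes R: "unital_subring R" and V: "left_submodule R V"
    and x: "x \<in> frame_power R V k" and y: "y \<in> frame_power R V (Suc l)"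
  shows "x * y \<in> frame_power R V (k + Suc l)"
proof -
  define P where "P = frame_power R V (k + Suc l)"
  have P: "left_submodule R P"
    unfolding P_def by (rule left_submodule_frame_power)
  let ?A = "{y. \<forall>r\<in>R. \<forall>vs. length vs = k \<longrightarrow> set vs \<subseteq> V \<longrightarrow> prod_list vs * (r * y) \<in> P}"
  have "frame_power R V (Suc l) \<subseteq> ?A"
  proof (rule frame_power_least)
    have "prod_list vs * (s * (r * y)) \<in> P"
      if "y \<in> ?A" "r \<in> R" "s \<in> R" "length vs = k" "set vs \<subseteq> V" for y r s vs
    proof -
      have "s * r \<in> R"
        using R that(2,3) by (simp add: unital_subring_def)
      then have "prod_list vs * ((s * r) * y) \<in> P"
        using that by blast
      then show ?thesis
        by (simp add: mult.assoc)
    qed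
    then show "left_submodule R ?A"
      by (auto simp: left_submodule_def additive_subgroup_def right_diff_distrib
          left_submodule_0[OF P] intro: left_submodule_diff[OF P])
  next
    fix ws
    assume ws: "length ws = Suc l" "set ws \<subseteq> V"
    then obtain w ws' where ws': "ws = w # ws'"
      by (cases ws) auto
    show "prod_list ws \<in> ?A"
    proof (intro CollectI ballI allI impI)
      fix r vs
      assume "r \<in> R" "length vs = k" "set vs \<subseteq> V"
      then have "prod_list (vs @ (r * w) # ws') \<in> P"
        unfolding P_def using ws ws' V by (intro prod_list_in_frame_power) (auto intro: left_submodule_smult)
      then show "prod_list vs * (r * prod_list ws) \<in> P"
        by (simp add: ws' mult.assoc)
    qed
  qed
  then have y': "prod_list vs * (1 * y) \<in> P" if "length vs = k" "set vs \<subseteq> V" for vs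
    using y that R unfolding unital_subring_def by blast
  have "frame_power R V k \<subseteq> {x. x * y \<in> P}"
  proof (rule frame_power_least)
    show "left_submodule R {x. x * y \<in> P}"
      by (auto simp: left_submodule_def additive_subgroup_def left_diff_distrib mult.assoc
          left_submodule_0[OF P] intro: left_submodule_diff[OF P] left_submodule_smult[OF P])
  qed (use y' in auto)
  then show ?thesis
    using x unfolding P_def by blast
qed

lemma frame_power_mono:
  assumes "1 \<in> V" "k \<le> l"
  shows "frame_power R V k \<subseteq> frame_power R V l"
proof (rule frame_power_least[OF left_submodule_frame_power])
  fix vs
  assume "length vs = k" "set vs \<subseteq> V"
  then have "prod_list (replicate (l - k) 1 @ vs) \<in> frame_power R V l"
    using assms by (intro prod_list_in_frame_power) (auto dest: in_set_replicate[THEN iffD1])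
  then show "prod_list vs \<in> frame_power R V l"
    by (simp add: prod_list_replicate)
qed

text \<open>
  The union of the positive powers is the subring generated by \<open>V\<close>; it contains \<open>R\<close> because
  \<open>1 \<in> V\<close>.
\<close>

lemma generating_frame_exhausts:
  assumes R: "unital_subring R" and V: "generating_frame R V"
  shows "\<exists>k. x \<in> frame_power R V (Suc k)"
proof -
  have Vs: "left_submodule R V" and 1: "1 \<in> V" and gen: "unital_subring hull (V \<union> R) = UNIV"
    using V by (auto simp: generating_frame_def frame_def)
  let ?S = "\<Union>k. frame_power R V (Suc k)"
  have VS: "v \<in> ?S" if "v \<in> V" for v
    using prod_list_in_frame_power[of "[v]" "Suc 0" V R] that by auto
  have "unital_subring ?S"
    unfolding unital_subring_def additive_subgroup_def
  proof (intro conjI ballI)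
    show "0 \<in> ?S" "1 \<in> ?S"
      using VS[of 0] VS[of 1] 1 left_submodule_0[OF Vs] by auto
  next
    fix x y
    assume "x \<in> ?S" "y \<in> ?S"
    then obtain k l where x: "x \<in> frame_power R V (Suc k)" and y: "y \<in> frame_power R V (Suc l)"
      by auto
    have "x \<in> frame_power R V (Suc (max k l))" "y \<in> frame_power R V (Suc (max k l))"
      using x y frame_power_mono[OF 1, of "Suc k" "Suc (max k l)" R]
        frame_power_mono[OF 1, of "Suc l" "Suc (max k l)" R] by auto
    then have "x - y \<in> frame_power R V (Suc (max k l))"
      by (rule left_submodule_diff[OF left_submodule_frame_power])
    then show "x - y \<in> ?S"
      by blast
    have "x * y \<in> frame_power R V (Suc (k + Suc l))"
      using frame_power_mult[OF R Vs x y] by simp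
    then show "x * y \<in> ?S"
      by blast
  qed
  moreover have "V \<union> R \<subseteq> ?S"
  proof -
    have "r \<in> V" if "r \<in> R" for r
      using left_submodule_smult[OF Vs that 1] by simp
    then show ?thesis
      using VS by blast
  qed
  ultimately have "unital_subring hull (V \<union> R) \<subseteq> ?S"
    by (intro hull_minimal)
  then show ?thesis
    using gen by auto
qed

lemma frame_subset_power_of_generating:
  assumes R: "unital_subring R" and V: "generating_frame R V" and W: "frame R W"
  obtains m where "W \<subseteq> frame_power R V (Suc m)"
proof -
  have 1: "1 \<in> V"
    using V by (auto simp: generating_frame_def frame_def)
  obtain X where X: "finite X" "W = left_submodule R hull X"
    using W by (auto simp: frame_def fin_dim_free_def)
  obtain f where f: "\<And>x. x \<in> frame_power R V (Suc (f x))"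
    using generating_frame_exhausts[OF R V] by metis
  have "X \<subseteq> frame_power R V (Suc (Max (f ` X)))"
  proof
    fix x
    assume "x \<in> X"
    then have "Suc (f x) \<le> Suc (Max (f ` X))"
      using X(1) by simp
    then show "x \<in> frame_power R V (Suc (Max (f ` X)))"
      using f frame_power_mono[OF 1] by blast
  qed
  then have "W \<subseteq> frame_power R V (Suc (Max (f ` X)))"
    unfolding X(2) by (intro hull_minimal left_submodule_frame_power)
  then show thesis
    by (rule that)
qed

lemma frame_power_subset_frame_power:
  assumes R: "unital_subring R" and V: "left_submodule R V" "1 \<in> V"
    and W: "W \<subseteq> frame_power R V (Suc m)"
  shows "frame_power R W k \<subseteq> frame_power R V (k * Suc m)"
proof (rule frame_power_least[OF left_submodule_frame_power])
  fix ws :: "'a list"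
  assume "length ws = k" "set ws \<subseteq> W"
  then show "prod_list ws \<in> frame_power R V (k * Suc m)"
  proof (induction ws arbitrary: k)
    case Nil
    then show ?case
      using prod_list_in_frame_power[of "[]" 0 V R] by simp
  next
    case (Cons w ws)
    then have w: "w \<in> frame_power R V (Suc m)"
      using W by auto
    show ?case
    proof (cases ws)
      case Nil
      then show ?thesis
        using Cons.prems w by auto
    next
      case (Cons w' ws')
      then obtain l where l: "length ws * Suc m = Suc l"
        by simp
      have "prod_list ws \<in> frame_power R V (length ws * Suc m)"
        using Cons.IH Cons.prems by simp
      then have "w * prod_list ws \<in> frame_power R V (Suc m + Suc l)"
        unfolding l by (rule frame_power_mult[OF R V(1) w])
      moreover have "k * Suc m = Suc m + length ws * Suc m"
        using Cons.prems(1) by auto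
      ultimately show ?thesis
        unfolding l by simp
    qed
  qed
qed

section \<open>Comparison of growth rates\<close>

lemma elog_mono:
  assumes "k \<ge> 2" "d \<le> e"
  shows "elog k d \<le> elog k e"
  using assms by (cases d; cases e) (auto simp: elog_def log_le_cancel_iff)

lemma elog_change_base:
  assumes "k \<ge> 2" "m \<ge> 1"
  shows "elog k d = ereal (log (real k) (real (k * m))) * elog (k * m) d"
proof -
  have "k * 1 \<le> k * m"
    using assms(2) by (intro mult_le_mono) auto
  then have km: "2 \<le> k * m"
    using assms(1) by linarith
  then have gt1: "1 < real (k * m)" "1 < real k"
    using assms(1) by linarith+
  then have pos: "0 < log (real k) (real (k * m))"
    by simp
  show ?thesis
  proof (cases d)
    case (enat n)
    then show ?thesis
      using pos gt1 by (auto simp: elog_def log_def simp del: of_nat_mult)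
  next
    case infinity
    then show ?thesis
      using pos by (simp add: elog_def)
  qed
qed

text \<open>
  Passing to the subsequence of multiples of \<open>m\<close> costs the factor \<open>log k (k m) = 1 + log k m\<close>,
  which disappears in the limit.
\<close>

lemma limsup_elog_multiple_le:
  fixes d :: "nat \<Rightarrow> enat"
  assumes m: "m \<ge> 1"
  shows "limsup (\<lambda>k. elog k (d (k * m))) \<le> limsup (\<lambda>k. elog k (d k))"
proof (rule dense_ge)
  fix z :: ereal
  assume "limsup (\<lambda>k. elog k (d k)) < z"
  then obtain y :: real where y: "limsup (\<lambda>k. elog k (d k)) < ereal y" "ereal y < z"
    using ereal_dense2 by blast
  define c where "c k = log (real k) (real (k * m))" for k :: nat
  have "(\<lambda>k. ereal (c k * y)) \<longlonglongrightarrow> ereal y"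
  proof -
    have "filterlim (\<lambda>k. ln (real k)) at_top sequentially"
      by (rule filterlim_compose[OF ln_at_top filterlim_real_sequentially])
    then have "(\<lambda>k. ln (real m) / ln (real k)) \<longlonglongrightarrow> 0"
      by (intro tendsto_divide_0[OF tendsto_const] filterlim_at_top_imp_at_infinity)
    then have "(\<lambda>k. 1 + ln (real m) / ln (real k)) \<longlonglongrightarrow> 1"
      using tendsto_add[OF tendsto_const[of 1]] by fastforce
    moreover have "\<forall>\<^sub>F k in sequentially. c k = 1 + ln (real m) / ln (real k)"
      using eventually_ge_at_top[of 2]
    proof eventually_elim
      case (elim k)
      then show ?case
        using m by (simp add: c_def log_def ln_mult add_divide_distrib)
    qed
    ultimately have "c \<longlonglongrightarrow> 1"
      by (simp add: tendsto_cong)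
    then have "(\<lambda>k. c k * y) \<longlonglongrightarrow> 1 * y"
      by (rule tendsto_mult_right)
    then show ?thesis
      by simp
  qed
  then have lim: "limsup (\<lambda>k. ereal (c k * y)) = ereal y"
    by (simp add: lim_imp_Limsup)
  have "\<forall>\<^sub>F n in sequentially. elog n (d n) < ereal y"
    using y(1) by (rule Limsup_lessD)
  moreover have "filterlim (\<lambda>k. k * m) sequentially sequentially"
    using m by (intro filterlim_at_top_mono[OF filterlim_ident]) (auto intro!: eventuallyI)
  ultimately have ev: "\<forall>\<^sub>F k in sequentially. elog (k * m) (d (k * m)) < ereal y"
    by (rule eventually_compose_filterlim)
  have "\<forall>\<^sub>F k in sequentially. elog k (d (k * m)) \<le> ereal (c k * y)"
    using ev eventually_ge_at_top[of 2]
  proof eventually_elim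
    case (elim k)
    have "0 < k * m"
      using elim(2) m by simp
    then have "1 \<le> real (k * m)"
      by linarith
    then have "0 \<le> c k"
      unfolding c_def using elim(2) by (intro zero_le_log_cancel_iff[THEN iffD2]) auto
    then have "ereal (c k) * elog (k * m) (d (k * m)) \<le> ereal (c k) * ereal y"
      using elim(1) by (intro ereal_mult_left_mono) auto
    then show ?case
      using elog_change_base[OF elim(2) m, of "d (k * m)"] by (simp add: c_def)
  qed
  then have "limsup (\<lambda>k. elog k (d (k * m))) \<le> limsup (\<lambda>k. ereal (c k * y))"
    by (rule Limsup_mono)
  then show "limsup (\<lambda>k. elog k (d (k * m))) \<le> z"
    using y(2) lim by simp
qed

lemma frame_growth_le_generating:
  assumes R: "unital_subring R" and V: "generating_frame R V" and W: "frame R W"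
  shows "frame_growth R W \<le> frame_growth R V"
proof -
  have Vs: "left_submodule R V" "1 \<in> V"
    using V by (auto simp: generating_frame_def frame_def)
  obtain m where m: "W \<subseteq> frame_power R V (Suc m)"
    by (rule frame_subset_power_of_generating[OF R V W])
  have "\<forall>\<^sub>F k in sequentially.
    elog k (udim R (frame_power R W k)) \<le> elog k (udim R (frame_power R V (k * Suc m)))"
    using eventually_ge_at_top[of 2]
    by eventually_elim
      (intro elog_mono udim_mono[OF R left_submodule_frame_power]
        frame_power_subset_frame_power[OF R Vs m])
  then have "frame_growth R W \<le> limsup (\<lambda>k. elog k (udim R (frame_power R V (k * Suc m))))"
    unfolding frame_growth_def by (rule Limsup_mono)
  also have "\<dots> \<le> frame_growth R V"
    unfolding frame_growth_def by (rule limsup_elog_multiple_le) simp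
  finally show ?thesis .
qed

lemma GGKdim_eq_frame_growth:
  assumes R: "unital_subring (B 0)" and V: "generating_frame (B 0) V"
  shows "GGKdim B = frame_growth (B 0) V"
proof (rule antisym)
  show "GGKdim B \<le> frame_growth (B 0) V"
    unfolding GGKdim_def using frame_growth_le_generating[OF R V] by (auto intro!: SUP_least)
  show "frame_growth (B 0) V \<le> GGKdim B"
    unfolding GGKdim_def using V by (auto simp: generating_frame_def intro!: SUP_upper)
qed

theorem proposition4p3:
  fixes B :: "nat \<Rightarrow> 'a::ring_1 set" and V :: "'a set"
  assumes "finitely_semi_graded B"
    and "left_noetherian_domain (B 0)"
    and "generating_frame (B 0) V"
  shows "GGKdim B = limsup (\<lambda>k. elog k (udim (B 0) (frame_power (B 0) V k))) \<and>
    (\<forall>W. generating_frame (B 0) W \<longrightarrow>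
       GGKdim B = limsup (\<lambda>k. elog k (udim (B 0) (frame_power (B 0) W k))))"
proof -
  have "unital_subring (B 0)"
    using assms(2) by (simp add: left_noetherian_domain_def)
  then show ?thesis
    using GGKdim_eq_frame_growth[of B] assms(3) by (simp add: frame_growth_def)
qed

end
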